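(* Let $Q\subset\mathbb{R}^n$ be a nonempty convex compact set of diameter $D$ with respect to a norm $\|\cdot\|$, and let $f:Q\to\mathbb{R}$ be a convex (sub)differentiable function, with $\nabla f(x)$ denoting its (sub)gradient at $x\in Q$. Let $f^*=\min_{x\in Q}f(x)$. Let $x_0,x_1,\dots,x_N$ be the points, $L_0,\dots,L_{N-1}$ the accepted parameters and $\alpha_0,\dots,\alpha_{N-1}$ the step sizes produced by the adaptive Frank–Wolfe algorithm (described in the context). Then for every $1\le k\le N$ $$f(x_k)-f^*\le \frac{2D^2\max_{0\le j\le k-1}L_j}{k+2}.$$ Moreover, for every $1\le k\le N$, if $\alpha_{k-1}=1$, then $$f(x_k)-f^*\le\frac{f(x_{k-1})-f^*}{2}.$$
   Context: The problem is $\min_{x\in Q}f(x)$. The vector $\nabla f(x)$ is a subgradient of $f$ at $x\in Q$, i.e. $f(y)\ge f(x)+\nabla f(x)^\top(y-x)$ for all $y\in Q$ (the gradient if $f$ is differentiable). The diameter is $D=\max_{x,y\in Q}\|x-y\|$. Adaptive Frank–Wolfe algorithm. Input: number of iterations $N$, starting point $x_0\in Q$, and $L_{-1}>0$. For $k=0,1,\dots,N-1$: 1. Set $L_k:=L_{k-1}/2$ and choose $s_k\in\arg\min_{x\in Q}\nabla f(x_k)^\top x$. 2. Set $d_k:=s_k-x_k$ and $\theta_k:=\min\left\{-\frac{\nabla f(x_k)^\top d_k}{L_k\|d_k\|^2},\,1\right\}$. 3. If $\theta_k<1$: if $f(x_k+\theta_kd_k)\le f(x_k)-\frac{(\nabla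 f(x_k)^\top d_k)^2}{2L_k\|d_k\|^2}$, accept $\alpha_k:=\theta_k$, set $x_{k+1}:=x_k+\alpha_kd_k$ and finish iteration $k$; otherwise replace $L_k$ by $2L_k$ and return to step 2. 4. If $\theta_k=1$: if $f(x_k+d_k)\le f(x_k)+\nabla f(x_k)^\top d_k+\frac{L_k}{2}\|d_k\|^2$, accept $\alpha_k:=1$, set $x_{k+1}:=x_k+d_k$ and finish iteration $k$; otherwise replace $L_k$ by $2L_k$ and return to step 2. Below and in the claim, $L_k$ denotes the final value with which iteration $k$ finished. No smoothness of $f$ is assumed; it is assumed that each of the $N$ iterations finishes (its exit criterion is met after finitely many doublings) and that $d_k\neq0$ at each performed iteration, so that $\theta_k$ is defined. *)

theory Defs
  imports "HOL-Analysis.Analysis"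
begin

text \<open>An arbitrary norm on \<open>real ^ 'n\<close>; the library constant \<^const>\<open>norm\<close> is only the
  Euclidean one.\<close>

definition is_norm :: "('a :: real_vector \<Rightarrow> real) \<Rightarrow> bool" where
  "is_norm nrm \<longleftrightarrow>
     (\<forall>v. 0 \<le> nrm v) \<and> (\<forall>v. nrm v = 0 \<longleftrightarrow> v = 0) \<and>
     (\<forall>c v. nrm (c *\<^sub>R v) = \<bar>c\<bar> * nrm v) \<and>
     (\<forall>v w. nrm (v + w) \<le> nrm v + nrm w)"

text \<open>Maximum and minimum over infinite sets are meant here, so \<^const>\<open>Max\<close> and \<^const>\<open>Min\<close>
  do not apply. Neither definition presupposes that the extremum is attained in the case at hand;
  for a compact set, and for a function on it with a subgradient at every point, it is.\<close>

definition diameter_wrt :: "('a :: real_vector \<Rightarrow> real) \<Rightarrow> 'a set \<Rightarrow> real" where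
  "diameter_wrt nrm Q = (GREATEST r. \<exists>x\<in>Q. \<exists>y\<in>Q. r = nrm (x - y))"

definition min_value :: "('a \<Rightarrow> real) \<Rightarrow> 'a set \<Rightarrow> real" where
  "min_value f Q = (LEAST r. r \<in> f ` Q)"

definition is_subgradient :: "'a :: real_inner set \<Rightarrow> ('a \<Rightarrow> real) \<Rightarrow> 'a \<Rightarrow> 'a \<Rightarrow> bool" where
  "is_subgradient Q f x v \<longleftrightarrow> (\<forall>y\<in>Q. f x + v \<bullet> (y - x) \<le> f y)"

definition trial_step :: "('a :: real_inner \<Rightarrow> real) \<Rightarrow> 'a \<Rightarrow> 'a \<Rightarrow> real \<Rightarrow> real" where
  "trial_step nrm v d L = min (- (v \<bullet> d) / (L * (nrm d)\<^sup>2)) 1"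

definition exit_criterion ::
  "('a :: real_inner \<Rightarrow> real) \<Rightarrow> ('a \<Rightarrow> real) \<Rightarrow> 'a \<Rightarrow> 'a \<Rightarrow> 'a \<Rightarrow> real \<Rightarrow> bool" where
  "exit_criterion nrm f v x d L \<longleftrightarrow>
     (if trial_step nrm v d L < 1
      then f (x + trial_step nrm v d L *\<^sub>R d) \<le> f x - (v \<bullet> d)\<^sup>2 / (2 * L * (nrm d)\<^sup>2)
      else f (x + d) \<le> f x + v \<bullet> d + L / 2 * (nrm d)\<^sup>2)"

text \<open>\<open>backtrack nrm f v x d L L'\<close>: the doubling loop started with the trial value \<open>L\<close> at the
  point \<open>x\<close>, with subgradient \<open>v\<close> and direction \<open>d\<close>, terminates with the final value \<open>L'\<close>.\<close>

inductive backtrack ::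
  "('a :: real_inner \<Rightarrow> real) \<Rightarrow> ('a \<Rightarrow> real) \<Rightarrow> 'a \<Rightarrow> 'a \<Rightarrow> 'a \<Rightarrow> real \<Rightarrow> real \<Rightarrow> bool"
  for nrm f v x d where
  accept: "exit_criterion nrm f v x d L \<Longrightarrow> backtrack nrm f v x d L L"
| double: "\<not> exit_criterion nrm f v x d L \<Longrightarrow> backtrack nrm f v x d (2 * L) L' \<Longrightarrow>
     backtrack nrm f v x d L L'"

text \<open>A run of \<open>N\<close> finished iterations of the adaptive Frank--Wolfe algorithm, with \<open>g\<close> in the role
  of \<open>\<nabla>f\<close> and \<open>L0\<close> in the role of \<open>L\<^sub>-\<^sub>1\<close>. Only the values \<open>x 0, \<dots>, x N\<close> and
  \<open>s k, L k, \<alpha> k\<close> for \<open>k < N\<close> are constrained.\<close>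

definition adaptive_FW_run ::
  "('a :: real_inner \<Rightarrow> real) \<Rightarrow> 'a set \<Rightarrow> ('a \<Rightarrow> real) \<Rightarrow> ('a \<Rightarrow> 'a) \<Rightarrow> nat \<Rightarrow> 'a \<Rightarrow> real \<Rightarrow>
   (nat \<Rightarrow> 'a) \<Rightarrow> (nat \<Rightarrow> 'a) \<Rightarrow> (nat \<Rightarrow> real) \<Rightarrow> (nat \<Rightarrow> real) \<Rightarrow> bool" where
  "adaptive_FW_run nrm Q f g N x0 L0 x s L \<alpha> \<longleftrightarrow>
     x 0 = x0 \<and>
     (\<forall>k<N.
        is_arg_min (\<lambda>y. g (x k) \<bullet> y) (\<lambda>y. y \<in> Q) (s k) \<and>
        backtrack nrm f (g (x k)) (x k) (s k - x k)
          ((case k of 0 \<Rightarrow> L0 | Suc j \<Rightarrow> L j) / 2) (L k) \<and>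
        \<alpha> k = trial_step nrm (g (x k)) (s k - x k) (L k) \<and>
        x (Suc k) = x k + \<alpha> k *\<^sub>R (s k - x k))"

end

theory Submission
  imports Defs
begin

text \<open>
  Write \<open>h k = f (x k) - min f\<close>, let \<open>d\<close> be the direction and \<open>v\<close> the subgradient used at \<open>x k\<close>,
  and let \<open>L\<close> be the accepted parameter. The Frank--Wolfe gap \<open>- (v \<bullet> d)\<close> bounds \<open>h k\<close> from above:
  the linear minorant of \<open>f\<close> at \<open>x k\<close> is minimised over \<open>Q\<close> at \<open>s k\<close>, and its value at a minimiser
  of \<open>f\<close> is at most the minimum of \<open>f\<close>. The exit criterion supplies the decrease that smoothness
  would otherwise give, so an accepted step falls into one of two cases.

  A short step (\<open>\<alpha> < 1\<close>) gives \<open>h (k + 1) \<le> h k - (h k)\<^sup>2 / C\<close> with \<open>C = 2 D\<^sup>2 L\<close>. For a full step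
  (\<open>\<alpha> = 1\<close>) the definition of the trial step says that \<open>L \<parallel>d\<parallel>\<^sup>2\<close> is at most the gap. The quadratic
  term of the exit criterion therefore costs at most half of the gap, which gives
  \<open>h (k + 1) \<le> h k / 2\<close>; and since the gap dominates \<open>h k\<close>, also
  \<open>h (k + 1) \<le> L \<parallel>d\<parallel>\<^sup>2 / 2 \<le> C / 4\<close>. These facts are collected in \<open>accepted_step_decrease\<close>.

  In both cases \<open>h 1 \<le> C / 4\<close>, whatever \<open>h 0\<close> is; this starts an induction that
  \<open>sublinear_rate_step\<close> carries on. Replacing \<open>L\<close> by the running maximum only increases \<open>C\<close>,
  so both inequalities may be used with the same, nondecreasing constant.
\<close>

section \<open>Attainment of the minimum and of the diameter\<close>

text \<open>A function with a subgradient at every point is lower semicontinuous, being bounded below near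
  each point by an affine function that agrees with it there. The proof is the covering argument for
  lower semicontinuous functions on a compact set.\<close>

lemma min_attained_if_subgradients:
  fixes f :: "'a :: real_inner \<Rightarrow> real"
  assumes "Q \<noteq> {}" "compact Q" and sub: "\<And>y. y \<in> Q \<Longrightarrow> is_subgradient Q f y (g y)"
  shows "\<exists>z\<in>Q. \<forall>y\<in>Q. f z \<le> f y"
proof (rule ccontr)
  assume "\<not> ?thesis"
  then have "\<forall>z\<in>Q. \<exists>y\<in>Q. f y < f z"
    by (meson linorder_not_le)
  then obtain b where b: "\<And>z. z \<in> Q \<Longrightarrow> b z \<in> Q \<and> f (b z) < f z"
    by metis
  \<comment> \<open>On \<open>U z\<close> the minorant at \<open>z\<close> keeps \<open>f\<close> above the better value \<open>f (b z)\<close>.\<close>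
  define U where "U z = {y. f (b z) < f z + g z \<bullet> (y - z)}" for z
  have "open (U z)" for z
    unfolding U_def by (intro open_Collect_less continuous_intros)
  moreover have "Q \<subseteq> (\<Union>z\<in>Q. U z)"
    using b by (force simp: U_def)
  ultimately obtain T where T: "T \<subseteq> Q" "finite T" "Q \<subseteq> (\<Union>z\<in>T. U z)"
    using compactE_image[OF \<open>compact Q\<close>, of Q U] by metis
  then have "T \<noteq> {}"
    using \<open>Q \<noteq> {}\<close> by auto
  then obtain z where z: "z \<in> T" "\<And>y. y \<in> T \<Longrightarrow> f (b z) \<le> f (b y)"
    using arg_min_if_finite(1)[OF \<open>finite T\<close>, of "\<lambda>y. f (b y)"]
      arg_min_least[OF \<open>finite T\<close>, of _ "\<lambda>y. f (b y)"] that by blast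
  then have "b z \<in> Q"
    using b T(1) by auto
  then obtain w where w: "w \<in> T" "b z \<in> U w"
    using T(3) by auto
  have "f w + g w \<bullet> (b z - w) \<le> f (b z)"
    using sub[of w] w(1) T(1) \<open>b z \<in> Q\<close> by (auto simp: is_subgradient_def)
  then show False
    using z(2)[OF w(1)] w(2) by (simp add: U_def)
qed

lemma min_value_eqI:
  assumes "z \<in> Q" "\<And>y. y \<in> Q \<Longrightarrow> f z \<le> f y"
  shows "min_value f Q = f z"
  unfolding min_value_def using assms by (intro Least_equality) auto

text \<open>In finite dimension every norm is continuous for the Euclidean topology, because it is a
  convex function on the whole space.\<close>

lemma continuous_on_is_norm:
  fixes nrm :: "'a :: euclidean_space \<Rightarrow> real"
  assumes "is_norm nrm"
  shows "continuous_on UNIV nrm"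
proof (rule convex_on_continuous)
  show "convex_on UNIV nrm"
  proof (rule convex_onI)
    fix t :: real and v w :: 'a
    assume "0 < t" "t < 1"
    have "nrm ((1 - t) *\<^sub>R v + t *\<^sub>R w) \<le> nrm ((1 - t) *\<^sub>R v) + nrm (t *\<^sub>R w)"
      using assms unfolding is_norm_def by blast
    also have "\<dots> = (1 - t) * nrm v + t * nrm w"
      using assms \<open>0 < t\<close> \<open>t < 1\<close> by (simp add: is_norm_def)
    finally show "nrm ((1 - t) *\<^sub>R v + t *\<^sub>R w) \<le> (1 - t) * nrm v + t * nrm w" .
  qed auto
qed auto

lemma nrm_diff_le_diameter_wrt:
  fixes nrm :: "'a :: euclidean_space \<Rightarrow> real"
  assumes "is_norm nrm" "compact Q" "y \<in> Q" "z \<in> Q"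
  shows "nrm (y - z) \<le> diameter_wrt nrm Q"
proof -
  have "continuous_on (Q \<times> Q) (\<lambda>p. nrm (fst p - snd p))"
    by (rule continuous_on_compose2[OF continuous_on_is_norm[OF assms(1)]])
      (auto intro!: continuous_intros)
  moreover have "compact (Q \<times> Q)" "Q \<times> Q \<noteq> {}"
    using assms by (auto intro: compact_Times)
  ultimately obtain p where p: "p \<in> Q \<times> Q"
      "\<And>q. q \<in> Q \<times> Q \<Longrightarrow> nrm (fst q - snd q) \<le> nrm (fst p - snd p)"
    using continuous_attains_sup[of "Q \<times> Q" "\<lambda>p. nrm (fst p - snd p)"] that by blast
  have "diameter_wrt nrm Q = nrm (fst p - snd p)"
    unfolding diameter_wrt_def
  proof (rule Greatest_equality)
    show "\<exists>y\<in>Q. \<exists>z\<in>Q. nrm (fst p - snd p) = nrm (y - z)"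
      using p(1) by (intro bexI[of _ "fst p"] bexI[of _ "snd p"]) auto
    show "r \<le> nrm (fst p - snd p)" if "\<exists>y\<in>Q. \<exists>z\<in>Q. r = nrm (y - z)" for r
    proof -
      from that obtain y z where "y \<in> Q" "z \<in> Q" "r = nrm (y - z)"
        by blast
      then show ?thesis
        using p(2)[of "(y, z)"] by simp
    qed
  qed
  then show ?thesis
    using p(2)[of "(y, z)"] assms by simp
qed

section \<open>One accepted step\<close>

lemma backtrack_accepts: "backtrack nrm f v x d L L' \<Longrightarrow> exit_criterion nrm f v x d L'"
  by (induction rule: backtrack.induct)

lemma backtrack_pos: "backtrack nrm f v x d L L' \<Longrightarrow> 0 < L \<Longrightarrow> 0 < L'"
  by (induction rule: backtrack.induct) auto

text \<open>The quantity \<open>h\<close> stands for the suboptimality of \<open>x\<close> and is used only through the fact that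
  the gap \<open>- (v \<bullet> d)\<close> dominates it.\<close>

lemma accepted_step_decrease:
  assumes exit: "exit_criterion nrm f v x d L"
    and gap: "0 \<le> h" "h \<le> - (v \<bullet> d)"
    and L: "0 < L" "L \<le> M" and nrm: "0 < nrm d" "nrm d \<le> D"
  defines "a \<equiv> trial_step nrm v d L"
  shows "a < 1 \<Longrightarrow> f (x + a *\<^sub>R d) \<le> f x - h\<^sup>2 / (2 * D\<^sup>2 * M)"
    and "a = 1 \<Longrightarrow> f (x + a *\<^sub>R d) \<le> f x - h / 2"
    and "a = 1 \<Longrightarrow> f (x + a *\<^sub>R d) \<le> f x - h + 2 * D\<^sup>2 * M / 4"
proof -
  have sq: "(nrm d)\<^sup>2 \<le> D\<^sup>2" "0 < (nrm d)\<^sup>2"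
    using nrm by (auto intro: power_mono)
  have scale: "L * (nrm d)\<^sup>2 \<le> D\<^sup>2 * M"
    using mult_mono[of L M "(nrm d)\<^sup>2" "D\<^sup>2"] sq L by (simp add: mult.commute)
  {
    assume a: "a < 1"
    have "h\<^sup>2 \<le> (v \<bullet> d)\<^sup>2"
      using power_mono[of h "- (v \<bullet> d)" 2] gap by simp
    moreover have "0 < 2 * L * (nrm d)\<^sup>2" "2 * L * (nrm d)\<^sup>2 \<le> 2 * D\<^sup>2 * M"
      using sq L scale by auto
    ultimately have "h\<^sup>2 / (2 * D\<^sup>2 * M) \<le> (v \<bullet> d)\<^sup>2 / (2 * L * (nrm d)\<^sup>2)"
      by (intro frac_le) auto
    then show "f (x + a *\<^sub>R d) \<le> f x - h\<^sup>2 / (2 * D\<^sup>2 * M)"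
      using exit a by (simp add: exit_criterion_def a_def)
  next
    assume a: "a = 1"
    have step: "f (x + a *\<^sub>R d) \<le> f x + v \<bullet> d + L * (nrm d)\<^sup>2 / 2"
      using exit a by (simp add: exit_criterion_def a_def)
    have "1 \<le> - (v \<bullet> d) / (L * (nrm d)\<^sup>2)"
      using a by (simp add: a_def trial_step_def min_def split: if_splits)
    then have "L * (nrm d)\<^sup>2 \<le> - (v \<bullet> d)"
      using sq L by (simp add: pos_le_divide_eq del: divide_minus_left)
    then show "f (x + a *\<^sub>R d) \<le> f x - h / 2"
      using step gap by linarith
    show "f (x + a *\<^sub>R d) \<le> f x - h + 2 * D\<^sup>2 * M / 4"
      using step gap scale by linarith
  }
qed

section \<open>The scalar recursion\<close>

text \<open>The map \<open>h \<mapsto> h - h\<^sup>2 / C\<close> is increasing up to \<open>C / 2\<close>, and \<open>C / n\<close> lies in that range as soon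
  as \<open>n \<ge> 2\<close>; so it suffices to evaluate at \<open>h = C / n\<close>, where \<open>(n - 1) / n\<^sup>2 \<le> 1 / (n + 1)\<close>.\<close>

lemma sublinear_rate_step:
  fixes h C n :: real
  assumes C: "0 < C" and n: "2 \<le> n" and h: "h \<le> C / n"
  shows "h - h\<^sup>2 / C \<le> C / (n + 1)"
proof -
  have "h / C \<le> 1 / n"
    using h C by (simp add: field_simps)
  then have "0 \<le> (1 / n - h / C) * (1 - 1 / n - h / C)"
  proof (intro mult_nonneg_nonneg)
    have "1 / n \<le> 1 / 2"
      using n by (simp add: field_simps)
    then show "0 \<le> 1 - 1 / n - h / C"
      using \<open>h / C \<le> 1 / n\<close> by linarith
  qed simp
  then have "h / C - (h / C)\<^sup>2 \<le> 1 / n - (1 / n)\<^sup>2"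
    by (simp add: algebra_simps power2_eq_square)
  also have "\<dots> \<le> 1 / (n + 1)"
    using n by (simp add: field_simps power2_eq_square)
  finally have "C * (h / C - (h / C)\<^sup>2) \<le> C * (1 / (n + 1))"
    using C by (intro mult_left_mono) auto
  moreover have "C * (h / C - (h / C)\<^sup>2) = h - h\<^sup>2 / C"
    using C by (simp add: right_diff_distrib power2_eq_square)
  ultimately show ?thesis
    by simp
qed

text \<open>The bound on \<open>h 1\<close> does not involve \<open>h 0\<close>: a short step gives \<open>h 0 - (h 0)\<^sup>2 / C \<le> C / 4\<close>
  by completing the square, and a full step gives \<open>C / 4\<close> directly.\<close>

lemma sublinear_rate:
  fixes h C :: "nat \<Rightarrow> real"
  assumes pos: "\<And>k. k < N \<Longrightarrow> 0 < C k"
    and mono: "\<And>k. Suc k < N \<Longrightarrow> C k \<le> C (Suc k)"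
    and step: "\<And>k. k < N \<Longrightarrow> h (Suc k) \<le> h k - (h k)\<^sup>2 / C k \<or>
                 h (Suc k) \<le> h k / 2 \<and> h (Suc k) \<le> C k / 4"
    and "k < N"
  shows "h (Suc k) \<le> C k / (real k + 3)"
  using \<open>k < N\<close>
proof (induction k)
  case 0
  have C: "0 < C 0"
    using pos 0 by blast
  have "h 0 - (h 0)\<^sup>2 / C 0 \<le> C 0 / 4"
  proof -
    have "0 \<le> (h 0 - C 0 / 2)\<^sup>2 / C 0"
      using C by simp
    also have "\<dots> = C 0 / 4 - (h 0 - (h 0)\<^sup>2 / C 0)"
      using C by (simp add: field_simps power2_eq_square)
    finally show ?thesis
      by simp
  qed
  then have "h (Suc 0) \<le> C 0 / 4"
    using step[OF 0] by linarith
  then show ?case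
    using C by simp
next
  case (Suc k)
  let ?n = "real k + 3"
  have C: "0 < C (Suc k)"
    using pos Suc.prems by blast
  have "h (Suc k) \<le> C k / ?n"
    using Suc by simp
  also have "\<dots> \<le> C (Suc k) / ?n"
    using mono[OF Suc.prems] by (intro divide_right_mono) auto
  finally have h: "h (Suc k) \<le> C (Suc k) / ?n" .
  have "h (Suc k) / 2 \<le> C (Suc k) / ?n / 2"
    using h by (intro divide_right_mono) auto
  also have "\<dots> = C (Suc k) / (?n * 2)"
    by (rule divide_divide_eq_left)
  also have "\<dots> \<le> C (Suc k) / (?n + 1)"
    using C by (intro divide_left_mono) auto
  finally have "h (Suc k) / 2 \<le> C (Suc k) / (?n + 1)" .
  moreover have "h (Suc k) - (h (Suc k))\<^sup>2 / C (Suc k) \<le> C (Suc k) / (?n + 1)"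
    using sublinear_rate_step[OF C _ h] by simp
  ultimately have "h (Suc (Suc k)) \<le> C (Suc k) / (?n + 1)"
    using step[OF Suc.prems] by linarith
  then show ?case
    by (simp add: add_ac)
qed

section \<open>Convergence of the adaptive Frank--Wolfe algorithm\<close>

theorem mainTheorem1:
  fixes Q :: "(real ^ 'n) set"
    and nrm :: "real ^ 'n \<Rightarrow> real"
    and f :: "real ^ 'n \<Rightarrow> real"
    and g :: "real ^ 'n \<Rightarrow> real ^ 'n"
    and N :: nat
    and x0 :: "real ^ 'n"
    and L0 :: real
    and x s :: "nat \<Rightarrow> real ^ 'n"
    and L \<alpha> :: "nat \<Rightarrow> real"
  assumes "is_norm nrm"
    and "Q \<noteq> {}" and "convex Q" and "compact Q"
    and "convex_on Q f"
    and "\<And>y. y \<in> Q \<Longrightarrow> is_subgradient Q f y (g y)"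
    and "x0 \<in> Q" and "L0 > 0"
    and "adaptive_FW_run nrm Q f g N x0 L0 x s L \<alpha>"
    and "\<And>k. k < N \<Longrightarrow> s k - x k \<noteq> 0"
  shows "(\<forall>k. 1 \<le> k \<and> k \<le> N \<longrightarrow>
            f (x k) - min_value f Q
              \<le> 2 * (diameter_wrt nrm Q)\<^sup>2 * Max (L ` {0..k - 1}) / (real k + 2)) \<and>
         (\<forall>k. 1 \<le> k \<and> k \<le> N \<and> \<alpha> (k - 1) = 1 \<longrightarrow>
            f (x k) - min_value f Q \<le> (f (x (k - 1)) - min_value f Q) / 2)"
proof -
  note nrm = assms(1) and sub = assms(6) and run = assms(9)[unfolded adaptive_FW_run_def]
  obtain z where z: "z \<in> Q" "\<And>y. y \<in> Q \<Longrightarrow> f z \<le> f y"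
    using min_attained_if_subgradients[of Q f g] assms by blast
  have min: "min_value f Q = f z"
    using z by (rule min_value_eqI)
  define D where "D = diameter_wrt nrm Q"
  define h where "h k = f (x k) - f z" for k
  define d where "d k = s k - x k" for k
  define M where "M k = Max (L ` {0..k})" for k

  have sQ: "s k \<in> Q" and s_min: "\<And>y. y \<in> Q \<Longrightarrow> g (x k) \<bullet> s k \<le> g (x k) \<bullet> y" if "k < N" for k
    using run that by (auto simp: is_arg_min_linorder)
  have bt: "backtrack nrm f (g (x k)) (x k) (d k)
      ((case k of 0 \<Rightarrow> L0 | Suc j \<Rightarrow> L j) / 2) (L k)" if "k < N" for k
    using run that by (simp add: d_def)
  have \<alpha>: "\<alpha> k = trial_step nrm (g (x k)) (d k) (L k)"
    and next_x: "x (Suc k) = x k + \<alpha> k *\<^sub>R d k" if "k < N" for k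
    using run that by (auto simp: d_def)

  have Lpos: "0 < L k" if "k < N" for k
    using that
  proof (induction k)
    case 0
    then show ?case
      using backtrack_pos[OF bt[OF 0]] assms(8) by simp
  next
    case (Suc k)
    then show ?case
      using backtrack_pos[OF bt[OF Suc.prems]] by simp
  qed
  have LM: "L k \<le> M k" for k
    unfolding M_def by (intro Max_ge) auto
  have M_mono: "M k \<le> M (Suc k)" for k
    unfolding M_def by (intro Max_mono) auto

  have \<alpha>_le: "\<alpha> k \<le> 1" if "k < N" for k
    using \<alpha>[OF that] by (simp add: trial_step_def)
  have xQ: "x k \<in> Q" if "k \<le> N" for k
    using that
  proof (induction k)
    case 0
    then show ?case
      using run assms(7) by simp
  next
    case (Suc k)
    then have k: "k < N" "x k \<in> Q"
      by auto
    have "0 \<le> - (g (x k) \<bullet> d k)"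
      using s_min[OF k(1) k(2)] by (simp add: d_def inner_diff_right)
    then have "0 \<le> \<alpha> k"
      unfolding \<alpha>[OF k(1)] trial_step_def using Lpos[OF k(1)]
      by (simp del: divide_minus_left)
    moreover have "x (Suc k) = (1 - \<alpha> k) *\<^sub>R x k + \<alpha> k *\<^sub>R s k"
      unfolding next_x[OF k(1)] by (simp add: d_def algebra_simps)
    ultimately show ?case
      using convexD[OF assms(3) k(2) sQ[OF k(1)]] \<alpha>_le[OF k(1)] by simp
  qed

  have h_nonneg: "0 \<le> h k" if "k < N" for k
    using z(2) xQ that by (simp add: h_def)
  have h_gap: "h k \<le> - (g (x k) \<bullet> d k)" if "k < N" for k
  proof -
    have "f (x k) + g (x k) \<bullet> (z - x k) \<le> f z"
      using sub[OF xQ] that z(1) by (simp add: is_subgradient_def)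
    then show ?thesis
      using s_min[OF that z(1)] by (simp add: h_def d_def inner_diff_right)
  qed
  have d_pos: "0 < nrm (d k)" if "k < N" for k
    using nrm assms(10)[OF that] unfolding is_norm_def d_def by (metis order_le_less)
  have d_le: "nrm (d k) \<le> D" if "k < N" for k
    unfolding D_def d_def using nrm_diff_le_diameter_wrt[OF nrm assms(4)] sQ xQ that by simp

  have decrease:
    "\<alpha> k < 1 \<Longrightarrow> h (Suc k) \<le> h k - (h k)\<^sup>2 / (2 * D\<^sup>2 * M k)"
    "\<alpha> k = 1 \<Longrightarrow> h (Suc k) \<le> h k / 2"
    "\<alpha> k = 1 \<Longrightarrow> h (Suc k) \<le> 2 * D\<^sup>2 * M k / 4" if "k < N" for k
  proof -
    note step = accepted_step_decrease[of nrm f "g (x k)" "x k" "d k" "L k" "h k" "M k" D,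
        OF backtrack_accepts[OF bt[OF that]] h_nonneg[OF that] h_gap[OF that]
          Lpos[OF that] LM d_pos[OF that] d_le[OF that],
        folded \<alpha>[OF that], folded next_x[OF that]]
    show "h (Suc k) \<le> h k - (h k)\<^sup>2 / (2 * D\<^sup>2 * M k)" if "\<alpha> k < 1"
      using step(1)[OF that] unfolding h_def by linarith
    show "h (Suc k) \<le> h k / 2" if "\<alpha> k = 1"
      using step(2)[OF that] unfolding h_def by argo
    show "h (Suc k) \<le> 2 * D\<^sup>2 * M k / 4" if "\<alpha> k = 1"
      using step(3)[OF that] unfolding h_def by linarith
  qed

  have rate: "h (Suc k) \<le> 2 * D\<^sup>2 * M k / (real k + 3)" if "k < N" for k
  proof (rule sublinear_rate[of N _ h, OF _ _ _ that])
    fix j assume j: "j < N"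
    show "0 < 2 * D\<^sup>2 * M j"
      using Lpos[OF j] LM[of j] d_pos[OF j] d_le[OF j] by simp
    show "h (Suc j) \<le> h j - (h j)\<^sup>2 / (2 * D\<^sup>2 * M j) \<or>
        h (Suc j) \<le> h j / 2 \<and> h (Suc j) \<le> 2 * D\<^sup>2 * M j / 4"
      using decrease[OF j] \<alpha>_le[OF j] by linarith
  next
    fix j
    show "2 * D\<^sup>2 * M j \<le> 2 * D\<^sup>2 * M (Suc j)"
      using M_mono by (intro mult_left_mono) auto
  qed

  show ?thesis
    unfolding min
  proof (intro conjI allI impI; elim conjE)
    fix k assume "1 \<le> k" "k \<le> N"
    then obtain j where k: "k = Suc j" "j < N"
      by (cases k) auto
    show "f (x k) - f z \<le> 2 * (diameter_wrt nrm Q)\<^sup>2 * Max (L ` {0..k - 1}) / (real k + 2)"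
      using rate[OF k(2)] by (simp add: k h_def D_def M_def add_ac)
  next
    fix k assume "1 \<le> k" "k \<le> N" "\<alpha> (k - 1) = 1"
    then obtain j where k: "k = Suc j" "j < N" "\<alpha> j = 1"
      by (cases k) auto
    show "f (x k) - f z \<le> (f (x (k - 1)) - f z) / 2"
      using decrease(2)[OF k(2,3)] by (simp add: k h_def)
  qed
qed

end
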